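(* Let $\alpha,\beta$ be irrational real numbers and let $B_m$ and $D_n$ denote the denominators of their $m$th and $n$th convergents. Let $\kappa:\mathbb{Z}_{\ge1}\to\mathbb{R}_{>0}$ be a function with $$\kappa(n)\log D_{n+1}\to\infty\quad\text{and}\quad\kappa(n)\to0\qquad(n\to\infty).$$ Let $H\ge1$ be an absolute constant, let $J_1,J_2:\mathbb{Z}_{\ge1}^2\to\mathbb{R}_{\ge1}$ be functions and let $a:\mathbb{Z}_{\ge1}\to\mathbb{Z}_{\ge1}$ be a function such that, for some $n_0\ge1$, the conditions $$1\le J_1(a(n),n)\le J(a(n),n),\qquad1\le J_2(a(n),n)\le J(a(n),n),$$ $$B_{a(n)+1}\le D_n,\qquad4^4H^3D_{n+1}<B_{a(n)}^3$$ hold for all $n\ge n_0$. Assume that $(n_k)_{k\ge1}$ is an increasing infinite sequence of positive integers and that, for each $k$, $(x_k,y_k,z_k,v_k)\in\mathbb{Z}^4\setminus\{\overline0\}$ is a non-zero solution of $$x_kB_{a(n_k)}+y_kB_{a(n_k)+1}=z_kD_{n_k}+v_kD_{n_k+1}$$ with $$|x_k|,|y_k|\le H\cdot J_1(a(n_k),n_k),\qquad|z_k|,|v_k|\le H\cdot J_2(a(n_k),n_k).$$ If $$J_1(a(n_k),n_k)^2\cdot J_2(a(n_k),n_k)\le D_{n_k+1}^{1-\kappa(n_k)}$$ for all $k\in\mathbb{Z}_{\ge1}$, then $\alpha$ and $\beta$ satisfy the Littlewood conjecture, i.e. $\liminf_{q\to\infty}q\,\|q\alpha\|\,\|q\bet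a\|=0$.
   Context: For real $x$, $\|x\|:=\min_{k\in\mathbb{Z}}|x-k|$; $q$ ranges over positive integers. For an irrational $\alpha=[b_0;b_1,b_2,\ldots]$ (simple continued fraction, $b_0\in\mathbb{Z}$, $b_n\in\mathbb{Z}_{\ge1}$ for $n\ge1$), the denominators of the convergents are given by $B_0=1$, $B_1=b_1$, $B_{n+2}=b_{n+2}B_{n+1}+B_n$; $D_n$ is defined likewise from the partial quotients of $\beta$. For $m,n\ge1$, $J(m,n):=\left\lfloor(B_m+B_{m+1}+D_n+D_{n+1})^{1/3}\right\rfloor$. *)

theory Defs
  imports "HOL-Analysis.Analysis"
begin

text \<open>
  Simple continued fraction of a real number by the floor algorithm.  For irrational \<open>x\<close>
  no remainder is an integer, so the division by \<open>frac\<close> never degenerates; the values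
  for rational \<open>x\<close> are irrelevant.
\<close>

fun cf_complete :: "real \<Rightarrow> nat \<Rightarrow> real" where
  "cf_complete x 0 = x"
| "cf_complete x (Suc n) = 1 / frac (cf_complete x n)"

definition cf_quot :: "real \<Rightarrow> nat \<Rightarrow> int" where
  "cf_quot x n = \<lfloor>cf_complete x n\<rfloor>"

fun cf_denom :: "real \<Rightarrow> nat \<Rightarrow> int" where
  "cf_denom x 0 = 1"
| "cf_denom x (Suc 0) = cf_quot x 1"
| "cf_denom x (Suc (Suc n)) = cf_quot x (Suc (Suc n)) * cf_denom x (Suc n) + cf_denom x n"

lemma cf_complete_irrational:
  assumes "x \<notin> \<rat>"
  shows "cf_complete x n \<notin> \<rat>"
proof (induction n)
  case 0
  then show ?case using assms by simp
next
  case (Suc n)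
  show ?case
  proof
    assume "cf_complete x (Suc n) \<in> \<rat>"
    then have "inverse (cf_complete x (Suc n)) \<in> \<rat>" by (rule Rats_inverse)
    then have "frac (cf_complete x n) \<in> \<rat>" by simp
    then have "frac (cf_complete x n) + of_int \<lfloor>cf_complete x n\<rfloor> \<in> \<rat>"
      by (intro Rats_add Rats_of_int)
    then show False using Suc by (simp add: frac_def)
  qed
qed

lemma cf_complete_step:
  "cf_complete x n = of_int (cf_quot x n) + 1 / cf_complete x (Suc n)"
  by (simp add: cf_quot_def frac_def)

lemma cf_quot_ge_1:
  assumes "x \<notin> \<rat>" and "n \<ge> 1"
  shows "cf_quot x n \<ge> 1"
proof -
  obtain m where n: "n = Suc m" using assms(2) by (cases n) auto
  have "cf_complete x m \<notin> \<int>"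
    using cf_complete_irrational[OF assms(1)] Ints_subset_Rats by blast
  then have "0 < frac (cf_complete x m)" by (simp add: frac_gt_0_iff)
  moreover have "frac (cf_complete x m) < 1" by (rule frac_lt_1)
  ultimately show ?thesis by (simp add: n cf_quot_def le_floor_iff field_simps)
qed

definition dist_to_int :: "real \<Rightarrow> real" where
  "dist_to_int x = infdist x \<int>"

lemma dist_to_int_is_min:
  "\<exists>k::int. dist_to_int x = \<bar>x - of_int k\<bar> \<and> (\<forall>l::int. \<bar>x - of_int k\<bar> \<le> \<bar>x - of_int l\<bar>)"
proof -
  obtain y where "y \<in> \<int>" "infdist x \<int> = dist x y"
    using infdist_attains_inf[of "\<int> :: real set" x] Ints_0 closed_Ints by blast
  then obtain k :: int where k: "infdist x \<int> = \<bar>x - of_int k\<bar>"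
    by (auto simp: dist_real_def elim!: Ints_cases)
  have "\<bar>x - of_int k\<bar> \<le> \<bar>x - of_int l\<bar>" for l :: int
    using infdist_le[of "of_int l" \<int> x] k by (simp add: dist_real_def)
  then show ?thesis using k unfolding dist_to_int_def by blast
qed

definition J_bound :: "real \<Rightarrow> real \<Rightarrow> nat \<Rightarrow> nat \<Rightarrow> int" where
  "J_bound \<alpha> \<beta> m n =
     \<lfloor>root 3 (real_of_int (cf_denom \<alpha> m + cf_denom \<alpha> (m + 1) + cf_denom \<beta> n + cf_denom \<beta> (n + 1)))\<rfloor>"

definition satisfies_Littlewood :: "real \<Rightarrow> real \<Rightarrow> bool" where
  "satisfies_Littlewood \<alpha> \<beta> \<longleftrightarrow>
     liminf (\<lambda>q::nat. ereal (real q * dist_to_int (real q * \<alpha>) * dist_to_int (real q * \<beta>))) = 0"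

end

(*
  Taking q as the absolute value of the common value of the two linear forms, the best
  approximation bounds |B_m \<alpha> - A_m| \<le> 1 / B_(m+1) give
  q ||q \<alpha>|| ||q \<beta>|| \<le> 8 H^3 J_1^2 J_2 / D_(n+1) \<le> 8 H^3 D_(n+1)^(-\<kappa>(n)), which tends to 0.
  The value q is nonzero because consecutive denominators are coprime, so a nontrivial zero
  of one of the forms has a coefficient of size at least B_m, while the coefficients are at
  most H J < B_m.  That q is unbounded need not be checked: for irrational \<alpha>, \<beta> each single
  product q ||q \<alpha>|| ||q \<beta>|| is positive, so arbitrarily small products force large q.
*)
theory Submission
  imports Defs
begin

section \<open>Denominators of convergents: growth, coprimality, approximation\<close>

lemma cf_complete_gt_1:
  assumes "x \<notin> \<rat>"
  shows "cf_complete x (Suc n) > 1"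
proof -
  have "cf_complete x n \<notin> \<int>"
    using cf_complete_irrational[OF assms] Ints_subset_Rats by blast
  then have "0 < frac (cf_complete x n)" by (simp add: frac_gt_0_iff)
  then show ?thesis using frac_lt_1[of "cf_complete x n"] by (simp add: field_simps)
qed

lemma cf_denom_ge_1:
  assumes "x \<notin> \<rat>"
  shows "cf_denom x n \<ge> 1"
proof (induction n rule: less_induct)
  case (less n)
  consider "n = 0" | "n = 1" | m where "n = Suc (Suc m)" by (metis One_nat_def not0_implies_Suc)
  then show ?case
  proof cases
    case 3
    have "cf_quot x n * cf_denom x (Suc m) \<ge> 1 * 1"
      using less[of "Suc m"] cf_quot_ge_1[OF assms, of n] 3 by (intro mult_mono) auto
    then show ?thesis using less[of m] 3 by simp
  qed (use cf_quot_ge_1[OF assms, of 1] in auto)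
qed

lemma cf_denom_mono_Suc:
  assumes "x \<notin> \<rat>"
  shows "cf_denom x n \<le> cf_denom x (Suc n)"
proof (cases n)
  case 0
  then show ?thesis using cf_denom_ge_1[OF assms, of 1] by simp
next
  case (Suc m)
  have "1 * cf_denom x n \<le> cf_quot x (Suc n) * cf_denom x n"
    using cf_quot_ge_1[OF assms, of "Suc n"] cf_denom_ge_1[OF assms, of n]
    by (intro mult_right_mono) auto
  then show ?thesis using cf_denom_ge_1[OF assms, of m] Suc by simp
qed

text \<open>The recurrence is a step of Euclid's algorithm run backwards, so the gcd of neighbours
  stays that of the first pair, which is 1.\<close>

lemma coprime_cf_denom: "coprime (cf_denom x n) (cf_denom x (Suc n))"
proof (induction n)
  case (Suc n)
  have "gcd (cf_denom x (Suc n)) (cf_denom x (Suc (Suc n))) = gcd (cf_denom x (Suc n)) (cf_denom x n)"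
    by (simp add: gcd_add_mult)
  then show ?case using Suc by (simp add: coprime_iff_gcd_eq_1 gcd.commute)
qed simp

text \<open>\<open>P\<close> and \<open>Q\<close> play the numerators of two consecutive
  convergents; carrying both errors lets the recurrence drive the induction. The last clause is the
  exact error formula |d| = 1 / (B_(n+1) + B_n / c_(n+2)), with c the complete quotients.\<close>

lemma cf_denom_approx_aux:
  assumes "x \<notin> \<rat>"
  shows "\<exists>P Q :: int. \<exists>d :: real. of_int (cf_denom x n) * x - of_int P = d
    \<and> of_int (cf_denom x (Suc n)) * x - of_int Q = - d / cf_complete x (Suc (Suc n))
    \<and> \<bar>d\<bar> * (of_int (cf_denom x (Suc n)) + of_int (cf_denom x n) / cf_complete x (Suc (Suc n))) = 1"
proof (induction n)
  case 0
  define c1 c2 where "c1 = cf_complete x 1" and "c2 = cf_complete x (Suc (Suc 0))"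
  have pos: "c1 > 1" "c2 > 1"
    using cf_complete_gt_1[OF assms, of 0] cf_complete_gt_1[OF assms, of 1]
    by (simp_all add: c1_def c2_def numeral_2_eq_2)
  have x: "x = of_int (cf_quot x 0) + 1 / c1"
    using cf_complete_step[of x 0] by (simp add: c1_def)
  have b1: "real_of_int (cf_quot x 1) = c1 - 1 / c2"
    using cf_complete_step[of x 1] by (simp add: c1_def c2_def numeral_2_eq_2)
  \<comment> \<open>The witnesses at index 0 are \<open>P = cf_quot x 0\<close>,
    \<open>Q = cf_quot x 1 * cf_quot x 0 + 1\<close> and \<open>d = 1 / c1\<close>.\<close>
  have "of_int (cf_quot x 1) * x - of_int (cf_quot x 1 * cf_quot x 0 + 1) = - (1 / c1) / c2"
  proof -
    have "x - of_int (cf_quot x 0) = 1 / c1" using x by linarith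
    then have "of_int (cf_quot x 1) * (x - of_int (cf_quot x 0)) - 1 = - (1 / c1) / c2"
      using pos unfolding b1 by (simp add: diff_divide_distrib mult.commute)
    then show ?thesis by (simp add: algebra_simps)
  qed
  moreover have "\<bar>1 / c1\<bar> * (of_int (cf_quot x 1) + 1 / c2) = 1"
    using pos unfolding b1 by simp
  moreover have "x - of_int (cf_quot x 0) = 1 / c1" using x by linarith
  ultimately show ?case
    unfolding c2_def[symmetric] cf_denom.simps of_int_1 mult_1 by blast
next
  case (Suc n)
  define c c' where "c = cf_complete x (Suc (Suc n))" and "c' = cf_complete x (Suc (Suc (Suc n)))"
  define b where "b = real_of_int (cf_quot x (Suc (Suc n)))"
  define B B' where "B = real_of_int (cf_denom x n)" and "B' = real_of_int (cf_denom x (Suc n))"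
  from Suc obtain P Q :: int and d :: real where
    P: "B * x - of_int P = d" and Q: "B' * x - of_int Q = - d / c"
    and d: "\<bar>d\<bar> * (B' + B / c) = 1"
    unfolding c_def B_def B'_def by blast
  have pos: "c > 1" "c' > 1"
    using cf_complete_gt_1[OF assms] unfolding c_def c'_def by blast+
  have b: "b = c - 1 / c'"
    using cf_complete_step[of x "Suc (Suc n)"] by (simp add: c_def c'_def b_def)
  \<comment> \<open>The numerators obey the same recurrence as the denominators. The new witnesses
    are \<open>Q\<close>, \<open>cf_quot x (Suc (Suc n)) * Q + P\<close> and the error
    \<open>- d / c\<close>.\<close>
  have "(b * B' + B) * x - of_int (cf_quot x (Suc (Suc n)) * Q + P)
      = b * (B' * x - of_int Q) + (B * x - of_int P)"
    by (simp add: b_def algebra_simps)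
  also have "\<dots> = - (- d / c) / c'"
    unfolding P Q b using pos by (simp add: field_simps)
  finally have 1: "(b * B' + B) * x - of_int (cf_quot x (Suc (Suc n)) * Q + P) = - (- d / c) / c'" .
  \<comment> \<open>Since \<open>b + 1 / c' = c\<close>, the product in the last clause does not
    change from one index to the next.\<close>
  have "\<bar>- d / c\<bar> * (b * B' + B + B' / c') = \<bar>d\<bar> * (B' + B / c)"
    unfolding b using pos by (simp add: field_simps)
  then have 2: "\<bar>- d / c\<bar> * (b * B' + B + B' / c') = 1" using d by (rule trans)
  have D: "of_int (cf_denom x (Suc (Suc n))) = b * B' + B"
    by (simp add: b_def B_def B'_def)
  show ?case
    unfolding D B'_def[symmetric] c'_def[symmetric] using 1 2 Q by blast
qed

lemma cf_denom_approx:
  assumes "x \<notin> \<rat>"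
  obtains P :: int where
    "\<bar>of_int (cf_denom x n) * x - of_int P\<bar> \<le> 1 / of_int (cf_denom x (Suc n))"
proof -
  obtain P :: int and d :: real where P: "of_int (cf_denom x n) * x - of_int P = d"
    and d: "\<bar>d\<bar> * (of_int (cf_denom x (Suc n)) + of_int (cf_denom x n) / cf_complete x (Suc (Suc n))) = 1"
    using cf_denom_approx_aux[OF assms, of n] by blast
  have "\<bar>d\<bar> * of_int (cf_denom x (Suc n)) \<le> 1"
  proof -
    have "of_int (cf_denom x n) / cf_complete x (Suc (Suc n)) \<ge> 0"
      using cf_denom_ge_1[OF assms, of n] cf_complete_gt_1[OF assms, of "Suc n"] by simp
    then have "\<bar>d\<bar> * (of_int (cf_denom x n) / cf_complete x (Suc (Suc n))) \<ge> 0" by simp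
    then show ?thesis using d unfolding distrib_left by linarith
  qed
  then show ?thesis
    using P cf_denom_ge_1[OF assms, of "Suc n"] by (intro that[of P]) (simp add: field_simps)
qed

section \<open>Distance to the nearest integer and forms in consecutive denominators\<close>

lemma dist_to_int_le: "dist_to_int x \<le> \<bar>x - of_int k\<bar>"
  using infdist_le[of "of_int k" \<int> x] by (simp add: dist_to_int_def dist_real_def)

lemma dist_to_int_nonneg: "dist_to_int x \<ge> 0"
  by (simp add: dist_to_int_def infdist_nonneg)

lemma dist_to_int_of_nat_mult_pos:
  assumes "x \<notin> \<rat>" and "q \<ge> 1"
  shows "dist_to_int (real q * x) > 0"
proof -
  obtain k :: int where k: "dist_to_int (real q * x) = \<bar>real q * x - of_int k\<bar>"
    using dist_to_int_is_min by blast
  have "real q * x \<noteq> of_int k"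
  proof
    assume "real q * x = of_int k"
    then have "x = of_int k / of_nat q" using assms(2) by (simp add: field_simps)
    then show False using assms(1) by simp
  qed
  then show ?thesis using k by simp
qed

lemma dist_to_int_abs_comb_le:
  fixes B C x y p q :: int
  assumes "\<bar>of_int B * \<xi> - of_int p\<bar> \<le> e" and "\<bar>of_int C * \<xi> - of_int q\<bar> \<le> e"
    and "of_int \<bar>x\<bar> \<le> M" and "of_int \<bar>y\<bar> \<le> M"
  shows "dist_to_int (of_int \<bar>x * B + y * C\<bar> * \<xi>) \<le> 2 * M * e"
proof -
  have e: "0 \<le> e" and M: "0 \<le> M" using assms by linarith+
  \<comment> \<open>The multiplier must be nonnegative to serve as a value of q; the sign
    \<open>s\<close> is absorbed into the approximating integer
    \<open>s * (x * p + y * q)\<close>.\<close>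
  define s where "s = sgn (x * B + y * C)"
  have s: "\<bar>real_of_int s\<bar> \<le> 1" by (simp add: s_def sgn_if)
  have "\<bar>x * B + y * C\<bar> = s * (x * B + y * C)" by (simp add: s_def abs_sgn mult.commute)
  then have "of_int \<bar>x * B + y * C\<bar> * \<xi> - of_int (s * (x * p + y * q))
      = of_int s * (of_int x * (of_int B * \<xi> - of_int p) + of_int y * (of_int C * \<xi> - of_int q))"
    by (simp add: algebra_simps)
  then have "\<bar>of_int \<bar>x * B + y * C\<bar> * \<xi> - of_int (s * (x * p + y * q))\<bar>
      \<le> \<bar>of_int x * (of_int B * \<xi> - of_int p) + of_int y * (of_int C * \<xi> - of_int q)\<bar>"
    using s by (simp only: abs_mult) (rule mult_left_le_one_le, auto)
  also have "\<dots> \<le> \<bar>of_int x\<bar> * \<bar>of_int B * \<xi> - of_int p\<bar> + \<bar>of_int y\<bar> * \<bar>of_int C * \<xi> - of_int q\<bar>"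
    unfolding abs_mult[symmetric] by (rule abs_triangle_ineq)
  also have "\<dots> \<le> M * e + M * e"
    using assms e M by (intro add_mono mult_mono) auto
  finally show ?thesis using dist_to_int_le[of "of_int \<bar>x * B + y * C\<bar> * \<xi>" "s * (x * p + y * q)"]
    by linarith
qed

text \<open>The two denominators have errors at most 1 / B_(n+1) and 1 / B_(n+2); the larger bound 1
  / B_(n+1) serves for both.\<close>

lemma dist_to_int_cf_denom_comb_le:
  assumes "\<xi> \<notin> \<rat>"
    and "of_int \<bar>x\<bar> \<le> M" and "of_int \<bar>y\<bar> \<le> M"
  shows "dist_to_int (of_int \<bar>x * cf_denom \<xi> n + y * cf_denom \<xi> (n + 1)\<bar> * \<xi>)
      \<le> 2 * M / of_int (cf_denom \<xi> (n + 1))"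
proof -
  obtain p :: int where p: "\<bar>of_int (cf_denom \<xi> n) * \<xi> - of_int p\<bar> \<le> 1 / of_int (cf_denom \<xi> (Suc n))"
    using cf_denom_approx[OF assms(1)] .
  obtain q :: int where "\<bar>of_int (cf_denom \<xi> (Suc n)) * \<xi> - of_int q\<bar> \<le> 1 / of_int (cf_denom \<xi> (Suc (Suc n)))"
    using cf_denom_approx[OF assms(1)] .
  also have "\<dots> \<le> 1 / of_int (cf_denom \<xi> (Suc n))"
    using cf_denom_mono_Suc[OF assms(1), of "Suc n"] cf_denom_ge_1[OF assms(1), of "Suc n"]
    by (intro divide_left_mono mult_pos_pos) (simp_all del: cf_denom.simps)
  finally show ?thesis using dist_to_int_abs_comb_le[OF p _ assms(2,3)] by simp
qed

text \<open>If the form vanished, B_n would divide y B_(n+1), hence y by coprimality. As |y| < B_n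
  this forces y = 0, and then x = 0.\<close>

lemma cf_denom_comb_nonzero:
  assumes "\<xi> \<notin> \<rat>"
    and "\<bar>x\<bar> < cf_denom \<xi> n" and "\<bar>y\<bar> < cf_denom \<xi> n"
    and "(x, y) \<noteq> (0, 0)"
  shows "x * cf_denom \<xi> n + y * cf_denom \<xi> (n + 1) \<noteq> 0"
proof
  assume eq: "x * cf_denom \<xi> n + y * cf_denom \<xi> (n + 1) = 0"
  then have "y * cf_denom \<xi> (Suc n) = cf_denom \<xi> n * (- x)" by (simp add: algebra_simps)
  then have "cf_denom \<xi> n dvd y * cf_denom \<xi> (Suc n)" by (metis dvd_triv_left)
  then have "cf_denom \<xi> n dvd y"
    using coprime_cf_denom coprime_dvd_mult_left_iff by blast
  then have "y = 0" using assms(3) dvd_imp_le_int[of y "cf_denom \<xi> n"] by fastforce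
  moreover from this have "x = 0" using eq cf_denom_ge_1[OF assms(1), of n] by simp
  ultimately show False using assms(4) by simp
qed

section \<open>From arbitrarily small products to a vanishing lower limit\<close>

lemma satisfies_LittlewoodI:
  assumes irr: "\<alpha> \<notin> \<rat>" "\<beta> \<notin> \<rat>"
    and small: "\<And>e. e > 0 \<Longrightarrow>
      \<exists>q\<ge>1. real q * dist_to_int (real q * \<alpha>) * dist_to_int (real q * \<beta>) < e"
  shows "satisfies_Littlewood \<alpha> \<beta>"
proof -
  define f where "f q = real q * dist_to_int (real q * \<alpha>) * dist_to_int (real q * \<beta>)" for q
  have pos: "f q > 0" if "q \<ge> 1" for q
    using that dist_to_int_of_nat_mult_pos[OF irr(1) that] dist_to_int_of_nat_mult_pos[OF irr(2) that]
    by (simp add: f_def)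
  have large: "\<exists>q\<ge>N. f q < e" if "e > 0" for N e
  proof -
    \<comment> \<open>A value below \<open>e'\<close> is below \<open>e\<close> and below all of
      \<open>f 1\<close>, ..., \<open>f N\<close>, so it is attained only beyond \<open>N\<close>.
      Inserting \<open>e\<close> also keeps the set nonempty when \<open>N = 0\<close>.\<close>
    define e' where "e' = Min (insert e (f ` {1..N}))"
    have "e' > 0" using that pos by (simp add: e'_def)
    then obtain q where q: "q \<ge> 1" "f q < e'" using small unfolding f_def by blast
    have "f q < e" using q(2) by (simp add: e'_def)
    moreover have "q \<ge> N"
    proof (rule ccontr)
      assume "\<not> q \<ge> N"
      then have "f q \<in> insert e (f ` {1..N})" using q(1) by simp
      then have "e' \<le> f q" unfolding e'_def by (intro Min_le) auto
      then show False using q(2) by simp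
    qed
    ultimately show ?thesis by blast
  qed
  have "f q \<ge> 0" for q by (simp add: f_def dist_to_int_nonneg)
  then have "liminf (\<lambda>q. ereal (f q)) \<ge> 0"
    by (intro Liminf_bounded always_eventually) simp
  moreover have "\<not> liminf (\<lambda>q. ereal (f q)) > 0"
  proof
    assume "0 < liminf (\<lambda>q. ereal (f q))"
    then obtain e where e: "0 < ereal e" "ereal e < liminf (\<lambda>q. ereal (f q))"
      using ereal_dense2 by blast
    from e(2) have "eventually (\<lambda>q. ereal e < ereal (f q)) sequentially"
      by (rule less_LiminfD)
    then obtain N where "\<And>q. q \<ge> N \<Longrightarrow> e < f q"
      by (auto simp: eventually_sequentially)
    then show False using large[of e N] e(1) by fastforce
  qed
  ultimately show ?thesis unfolding satisfies_Littlewood_def f_def by auto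
qed

section \<open>Size of the coefficients and the estimate of the products\<close>

lemma J_bound_cube_le:
  assumes "\<alpha> \<notin> \<rat>" and "\<beta> \<notin> \<rat>"
    and "cf_denom \<alpha> (m + 1) \<le> cf_denom \<beta> n"
    and "1 \<le> J" and "J \<le> real_of_int (J_bound \<alpha> \<beta> m n)"
  shows "J ^ 3 \<le> 4 * real_of_int (cf_denom \<beta> (n + 1))"
proof -
  define S where "S = real_of_int (cf_denom \<alpha> m + cf_denom \<alpha> (m + 1) + cf_denom \<beta> n + cf_denom \<beta> (n + 1))"
  have le: "cf_denom \<alpha> m \<le> cf_denom \<alpha> (m + 1)" "cf_denom \<beta> n \<le> cf_denom \<beta> (n + 1)"
    using cf_denom_mono_Suc assms(1,2) by simp_all
  \<comment> \<open>The summands are ordered as B_m \<le> B_(m+1) \<le> D_n \<le> D_(n+1).\<close>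
  have "cf_denom \<alpha> m + cf_denom \<alpha> (m + 1) + cf_denom \<beta> n + cf_denom \<beta> (n + 1) \<le> 4 * cf_denom \<beta> (n + 1)"
    using le assms(3) by linarith
  then have S: "S \<le> 4 * real_of_int (cf_denom \<beta> (n + 1))"
    unfolding S_def by linarith
  have "0 \<le> S"
    using cf_denom_ge_1[OF assms(1), of m] cf_denom_ge_1[OF assms(1), of "m + 1"]
      cf_denom_ge_1[OF assms(2), of n] cf_denom_ge_1[OF assms(2), of "n + 1"]
    unfolding S_def by linarith
  have "J \<le> root 3 S"
    using assms(5) unfolding J_bound_def S_def by linarith
  then have "J ^ 3 \<le> root 3 S ^ 3" using assms(4) by (intro power_mono) auto
  also have "\<dots> = S" using \<open>0 \<le> S\<close> by (intro real_root_pow_pos2) auto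
  finally show ?thesis using S by linarith
qed

theorem theorem19:
  fixes \<alpha> \<beta> H :: real
    and \<kappa> :: "nat \<Rightarrow> real"
    and J1 J2 :: "nat \<Rightarrow> nat \<Rightarrow> real"
    and a nseq :: "nat \<Rightarrow> nat"
    and n0 :: nat
    and x y z v :: "nat \<Rightarrow> int"
  assumes "\<alpha> \<notin> \<rat>" and "\<beta> \<notin> \<rat>"
    and "\<And>n. n \<ge> 1 \<Longrightarrow> \<kappa> n > 0"
    and "filterlim (\<lambda>n. \<kappa> n * ln (real_of_int (cf_denom \<beta> (n + 1)))) at_top sequentially"
    and "\<kappa> \<longlonglongrightarrow> 0"
    and "H \<ge> 1"
    and "\<And>m n. m \<ge> 1 \<Longrightarrow> n \<ge> 1 \<Longrightarrow> J1 m n \<ge> 1"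
    and "\<And>m n. m \<ge> 1 \<Longrightarrow> n \<ge> 1 \<Longrightarrow> J2 m n \<ge> 1"
    and "\<And>n. n \<ge> 1 \<Longrightarrow> a n \<ge> 1"
    and "n0 \<ge> 1"
    and "\<And>n. n \<ge> n0 \<Longrightarrow> 1 \<le> J1 (a n) n \<and> J1 (a n) n \<le> real_of_int (J_bound \<alpha> \<beta> (a n) n)"
    and "\<And>n. n \<ge> n0 \<Longrightarrow> 1 \<le> J2 (a n) n \<and> J2 (a n) n \<le> real_of_int (J_bound \<alpha> \<beta> (a n) n)"
    and "\<And>n. n \<ge> n0 \<Longrightarrow> cf_denom \<alpha> (a n + 1) \<le> cf_denom \<beta> n"
    and "\<And>n. n \<ge> n0 \<Longrightarrow>
           4 ^ 4 * H ^ 3 * real_of_int (cf_denom \<beta> (n + 1)) < real_of_int (cf_denom \<alpha> (a n)) ^ 3"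
    and "strict_mono_on {1..} nseq"
    and "\<And>k. k \<ge> 1 \<Longrightarrow> nseq k \<ge> 1"
    and "\<And>k. k \<ge> 1 \<Longrightarrow> (x k, y k, z k, v k) \<noteq> (0, 0, 0, 0)"
    and "\<And>k. k \<ge> 1 \<Longrightarrow>
           x k * cf_denom \<alpha> (a (nseq k)) + y k * cf_denom \<alpha> (a (nseq k) + 1)
             = z k * cf_denom \<beta> (nseq k) + v k * cf_denom \<beta> (nseq k + 1)"
    and "\<And>k. k \<ge> 1 \<Longrightarrow> real_of_int \<bar>x k\<bar> \<le> H * J1 (a (nseq k)) (nseq k)
                      \<and> real_of_int \<bar>y k\<bar> \<le> H * J1 (a (nseq k)) (nseq k)"
    and "\<And>k. k \<ge> 1 \<Longrightarrow> real_of_int \<bar>z k\<bar> \<le> H * J2 (a (nseq k)) (nseq k)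
                      \<and> real_of_int \<bar>v k\<bar> \<le> H * J2 (a (nseq k)) (nseq k)"
    and "\<And>k. k \<ge> 1 \<Longrightarrow>
           (J1 (a (nseq k)) (nseq k))\<^sup>2 * J2 (a (nseq k)) (nseq k)
             \<le> real_of_int (cf_denom \<beta> (nseq k + 1)) powr (1 - \<kappa> (nseq k))"
  shows "satisfies_Littlewood \<alpha> \<beta>"
proof (rule satisfies_LittlewoodI)
  note irr = assms(1,2) and divergent = assms(4) and H = assms(6) and J = assms(11,12)
    and BD = assms(13) and gap = assms(14) and mono = assms(15) and nontriv = assms(17)
    and eq = assms(18) and xy = assms(19) and zv = assms(20) and JJ = assms(21)
  show "\<alpha> \<notin> \<rat>" "\<beta> \<notin> \<rat>" by (fact irr)+
  fix e :: real assume "e > 0"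
  \<comment> \<open>The index is shifted: \<open>D n\<close> stands for D_(n+1).\<close>
  define D where "D n = real_of_int (cf_denom \<beta> (n + 1))" for n
  have nseq_ge: "nseq k \<ge> k" if "k \<ge> 1" for k
    using that
  proof (induction k rule: nat_induct_at_least)
    case base
    then show ?case using assms(16) by simp
  next
    case (Suc k)
    then show ?case using strict_mono_onD[OF mono, of k "Suc k"] by simp
  qed
  \<comment> \<open>The threshold is the one at which the final bound 8 H^3 D_(n+1)^(-\<kappa>(n))
    drops below \<open>e\<close>.\<close>
  have "eventually (\<lambda>n. \<kappa> n * ln (D n) > ln (8 * H ^ 3 / e)) sequentially"
    using divergent unfolding D_def by (rule filterlim_at_top_dense[THEN iffD1, rule_format])
  then obtain N where N: "\<And>n. n \<ge> N \<Longrightarrow> \<kappa> n * ln (D n) > ln (8 * H ^ 3 / e)"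
    by (auto simp: eventually_sequentially)
  \<comment> \<open>For a given \<open>e\<close> a single solution suffices; since
    \<open>nseq k \<ge> k\<close>, this index puts \<open>n\<close> past both \<open>n0\<close> and
    \<open>N\<close>.\<close>
  define k where "k = max 1 (max n0 N)"
  define n m where "n = nseq k" and "m = a n"
  have k: "k \<ge> 1" and "n \<ge> n0" "n \<ge> N"
    using nseq_ge[of k] by (simp_all add: k_def n_def)
  define j1 j2 where "j1 = J1 m n" and "j2 = J2 m n"
  define A B where "A = cf_denom \<alpha> m" and "B = real_of_int (cf_denom \<alpha> (m + 1))"
  have J1: "1 \<le> j1" "j1 ^ 3 \<le> 4 * D n" and J2: "1 \<le> j2" "j2 ^ 3 \<le> 4 * D n"
    using J[OF \<open>n \<ge> n0\<close>] J_bound_cube_le[OF irr, of m n] BD[OF \<open>n \<ge> n0\<close>]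
    by (auto simp: j1_def j2_def m_def D_def)
  have B: "B \<ge> 1" and D: "D n \<ge> 1" and AB: "real_of_int A \<le> B" and A: "A \<ge> 1"
    and AD: "A \<le> cf_denom \<beta> n"
    using cf_denom_ge_1[OF irr(1)] cf_denom_ge_1[OF irr(2)] cf_denom_mono_Suc[OF irr(1), of m]
      BD[OF \<open>n \<ge> n0\<close>]
    by (simp_all add: B_def A_def D_def m_def)
  \<comment> \<open>Comparing cubes: (H j)^3 \<le> 4 H^3 D_(n+1) \<le> 4^4 H^3 D_(n+1) <
    B_m^3.\<close>
  have coeff_small: "H * j < A" if "1 \<le> j" "j ^ 3 \<le> 4 * D n" for j
  proof -
    have "(H * j) ^ 3 \<le> H ^ 3 * (4 * D n)"
      using H that by (simp add: power_mult_distrib)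
    also have "\<dots> \<le> 4 ^ 4 * H ^ 3 * D n"
      using H D by simp
    also have "\<dots> < real_of_int A ^ 3"
      using gap[OF \<open>n \<ge> n0\<close>] by (simp add: D_def A_def m_def)
    finally show ?thesis
      using A by (intro power_less_imp_less_base[of "H * j" 3]) simp_all
  qed
  have xy': "of_int \<bar>x k\<bar> \<le> H * j1" "of_int \<bar>y k\<bar> \<le> H * j1"
    and zv': "of_int \<bar>z k\<bar> \<le> H * j2" "of_int \<bar>v k\<bar> \<le> H * j2"
    using xy[OF k] zv[OF k] by (simp_all add: j1_def j2_def m_def n_def)
  define q where "q = nat \<bar>x k * cf_denom \<alpha> m + y k * cf_denom \<alpha> (m + 1)\<bar>"
  have eq': "x k * cf_denom \<alpha> m + y k * cf_denom \<alpha> (m + 1)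
      = z k * cf_denom \<beta> n + v k * cf_denom \<beta> (n + 1)"
    using eq[OF k] by (simp add: m_def n_def)
  have small: "\<bar>x k\<bar> < A" "\<bar>y k\<bar> < A" "\<bar>z k\<bar> < A" "\<bar>v k\<bar> < A"
    using xy' zv' coeff_small[OF J1] coeff_small[OF J2] by linarith+
  have "x k * cf_denom \<alpha> m + y k * cf_denom \<alpha> (m + 1) \<noteq> 0"
  proof (cases "(x k, y k) = (0, 0)")
    case False
    then show ?thesis using small by (intro cf_denom_comb_nonzero irr) (simp_all add: A_def)
  next
    \<comment> \<open>Here the other side of the equation is the nontrivial form; since B_m \<le>
      D_n, its coefficients are below D_n as well.\<close>
    case True
    then have "(z k, v k) \<noteq> (0, 0)" using nontriv[OF k] by simp
    then show ?thesis
      unfolding eq' using small AD by (intro cf_denom_comb_nonzero irr) simp_all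
  qed
  then have q1: "q \<ge> 1" by (simp add: q_def)
  have q: "real q = of_int \<bar>x k * cf_denom \<alpha> m + y k * cf_denom \<alpha> (m + 1)\<bar>"
    by (simp add: q_def)
  have "real q \<le> \<bar>of_int (x k)\<bar> * of_int A + \<bar>of_int (y k)\<bar> * B"
    using abs_triangle_ineq[of "of_int (x k) * real_of_int A" "of_int (y k) * B"] A B
    by (simp add: q A_def B_def abs_mult)
  also have "\<dots> \<le> H * j1 * B + H * j1 * B"
    using xy' AB A B H J1(1) by (intro add_mono mult_mono) auto
  finally have q_le: "real q \<le> 2 * (H * j1) * B" by (simp add: algebra_simps)
  have a_le: "dist_to_int (real q * \<alpha>) \<le> 2 * (H * j1) / B"
    unfolding q B_def by (rule dist_to_int_cf_denom_comb_le[OF irr(1) xy'])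
  \<comment> \<open>By \<open>eq'\<close> the same \<open>q\<close> is the absolute value of the
    form in the denominators of \<beta>.\<close>
  have b_le: "dist_to_int (real q * \<beta>) \<le> 2 * (H * j2) / D n"
    unfolding q D_def eq' by (rule dist_to_int_cf_denom_comb_le[OF irr(2) zv'])
  have "real q * dist_to_int (real q * \<alpha>) * dist_to_int (real q * \<beta>)
      \<le> (2 * (H * j1) * B) * (2 * (H * j1) / B) * (2 * (H * j2) / D n)"
    using q_le a_le b_le B D H J1(1) J2(1) by (intro mult_mono mult_nonneg_nonneg dist_to_int_nonneg) auto
  \<comment> \<open>The size B_(m+1) of \<open>q\<close> cancels against the approximation quality
    of \<alpha>; each of the three factors contributes 2 H.\<close>
  also have "\<dots> = 8 * H ^ 3 * (j1\<^sup>2 * j2 / D n)"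
    using B by (simp add: power2_eq_square power3_eq_cube)
  also have "\<dots> \<le> 8 * H ^ 3 * (D n powr (1 - \<kappa> n) / D n)"
    using JJ[OF k] H D
    by (intro mult_left_mono divide_right_mono) (simp_all add: j1_def j2_def D_def m_def n_def)
  also have "\<dots> = 8 * H ^ 3 * exp (- (\<kappa> n * ln (D n)))"
    using D by (simp add: powr_def left_diff_distrib exp_diff exp_minus field_simps)
  also have "\<dots> < 8 * H ^ 3 * exp (- ln (8 * H ^ 3 / e))"
    using N[OF \<open>n \<ge> N\<close>] H by (intro mult_strict_left_mono) simp_all
  also have "\<dots> = e" using H \<open>e > 0\<close> by (simp add: exp_minus)
  finally show "\<exists>q\<ge>1. real q * dist_to_int (real q * \<alpha>) * dist_to_int (real q * \<beta>) < e"
    using q1 by blast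
qed

end
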